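(* \textsc{ConsCheck: Split Graph} can be solved in time $\mathcal{O}(|\mathcal{I}|^3)$, where $|\mathcal{I}|$ is the size of the input.
   Context: A pair $(X,Y)$ of vertex subsets of a graph $G=(V,E)$ is a split if $(X,Y)$ is a bipartition of $V$ such that $X$ is a clique and $Y$ is an independent set in $G$. \textsc{ConsCheck: Split Graph} is the problem: Input $\mathcal{I}$: a finite vertex set $V$ and labeled samples $(E_i,\lambda_i)_{i\in[t]}$, where each $G_i=(V,E_i)$ is a graph and $\lambda_i\in\{0,1\}$. Task: compute a set $X\subseteq V$ such that for every $i\in[t]$, $(X,V\setminus X)$ is a split in $G_i$ if and only if $\lambda_i=1$, or correctly report that no such set exists. *)

theory Defs
  imports Complex_Main "HOL-Library.Landau_Symbols"
begin

section \<open>Splits and consistency with labelled samples\<close>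

definition graph_on :: "'a set \<Rightarrow> 'a set set \<Rightarrow> bool" where
  "graph_on V E \<longleftrightarrow> E \<subseteq> {{u, v} | u v. u \<in> V \<and> v \<in> V \<and> u \<noteq> v}"

definition clique :: "'a set set \<Rightarrow> 'a set \<Rightarrow> bool" where
  "clique E X \<longleftrightarrow> (\<forall>u\<in>X. \<forall>v\<in>X. u \<noteq> v \<longrightarrow> {u, v} \<in> E)"

definition independent_set :: "'a set set \<Rightarrow> 'a set \<Rightarrow> bool" where
  "independent_set E Y \<longleftrightarrow> (\<forall>u\<in>Y. \<forall>v\<in>Y. u \<noteq> v \<longrightarrow> {u, v} \<notin> E)"

text \<open>As usual for split graphs, either part of the bipartition may be empty.\<close>

definition is_split :: "'a set \<Rightarrow> 'a set set \<Rightarrow> 'a set \<Rightarrow> 'a set \<Rightarrow> bool" where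
  "is_split V E X Y \<longleftrightarrow>
     X \<union> Y = V \<and> X \<inter> Y = {} \<and> clique E X \<and> independent_set E Y"

definition split_instance :: "'a set \<Rightarrow> ('a set set \<times> bool) list \<Rightarrow> bool" where
  "split_instance V S \<longleftrightarrow> finite V \<and> (\<forall>(E, l)\<in>set S. graph_on V E)"

definition split_consistent :: "'a set \<Rightarrow> ('a set set \<times> bool) list \<Rightarrow> 'a set \<Rightarrow> bool" where
  "split_consistent V S X \<longleftrightarrow>
     X \<subseteq> V \<and> (\<forall>i<length S. is_split V (fst (S ! i)) X (V - X) \<longleftrightarrow> snd (S ! i))"


section \<open>A word RAM\<close>

text \<open>
  Programs are structured programs over registers and zero-initialised arrays, both named by
  natural numbers; a program mentions only finitely many of them. All words have \<open>w\<close> bits: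
  constants and sums are reduced modulo \<open>2 ^ w\<close>, and subtraction is truncated at \<open>0\<close>. Every node
  of an evaluated expression, every assignment and every evaluation of a branching condition costs
  one time unit.
\<close>

datatype exp =
    Const nat
  | Reg nat
  | Read nat exp
  | Add exp exp
  | Sub exp exp

datatype cond =
    Less exp exp
  | Equal exp exp
  | Neg cond
  | Conj cond cond

datatype com =
    Skip
  | Assign nat exp
  | Write nat exp exp
  | Seq com com
  | Ite cond com com
  | While cond com

type_synonym state = "(nat \<Rightarrow> nat) \<times> (nat \<Rightarrow> nat \<Rightarrow> nat)"

primrec exp_val :: "nat \<Rightarrow> state \<Rightarrow> exp \<Rightarrow> nat" where
  "exp_val w s (Const n) = n mod 2 ^ w"
| "exp_val w s (Reg r) = fst s r"
| "exp_val w s (Read a e) = snd s a (exp_val w s e)"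
| "exp_val w s (Add e f) = (exp_val w s e + exp_val w s f) mod 2 ^ w"
| "exp_val w s (Sub e f) = exp_val w s e - exp_val w s f"

primrec exp_cost :: "exp \<Rightarrow> nat" where
  "exp_cost (Const n) = 1"
| "exp_cost (Reg r) = 1"
| "exp_cost (Read a e) = exp_cost e + 1"
| "exp_cost (Add e f) = exp_cost e + exp_cost f + 1"
| "exp_cost (Sub e f) = exp_cost e + exp_cost f + 1"

primrec cond_val :: "nat \<Rightarrow> state \<Rightarrow> cond \<Rightarrow> bool" where
  "cond_val w s (Less e f) \<longleftrightarrow> exp_val w s e < exp_val w s f"
| "cond_val w s (Equal e f) \<longleftrightarrow> exp_val w s e = exp_val w s f"
| "cond_val w s (Neg b) \<longleftrightarrow> \<not> cond_val w s b"
| "cond_val w s (Conj b c) \<longleftrightarrow> cond_val w s b \<and> cond_val w s c"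

primrec cond_cost :: "cond \<Rightarrow> nat" where
  "cond_cost (Less e f) = exp_cost e + exp_cost f + 1"
| "cond_cost (Equal e f) = exp_cost e + exp_cost f + 1"
| "cond_cost (Neg b) = cond_cost b + 1"
| "cond_cost (Conj b c) = cond_cost b + cond_cost c + 1"

text \<open>\<open>exec w c s \<tau> s'\<close>: started in \<open>s\<close>, the program \<open>c\<close> halts after \<open>\<tau>\<close> time units in \<open>s'\<close>.\<close>

inductive exec :: "nat \<Rightarrow> com \<Rightarrow> state \<Rightarrow> nat \<Rightarrow> state \<Rightarrow> bool" for w :: nat where
  Skip: "exec w Skip s 1 s"
| Assign: "exec w (Assign r e) s (exp_cost e + 1) ((fst s)(r := exp_val w s e), snd s)"
| Write: "exec w (Write a i e) s (exp_cost i + exp_cost e + 1)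
    (fst s, (snd s)(a := (snd s a)(exp_val w s i := exp_val w s e)))"
| Seq: "exec w c s m s' \<Longrightarrow> exec w d s' n s'' \<Longrightarrow> exec w (Seq c d) s (m + n) s''"
| IteTrue: "cond_val w s b \<Longrightarrow> exec w c s n s' \<Longrightarrow> exec w (Ite b c d) s (cond_cost b + 1 + n) s'"
| IteFalse: "\<not> cond_val w s b \<Longrightarrow> exec w d s n s' \<Longrightarrow> exec w (Ite b c d) s (cond_cost b + 1 + n) s'"
| WhileFalse: "\<not> cond_val w s b \<Longrightarrow> exec w (While b c) s (cond_cost b + 1) s"
| WhileTrue: "cond_val w s b \<Longrightarrow> exec w c s m s' \<Longrightarrow> exec w (While b c) s' n s'' \<Longrightarrow>
    exec w (While b c) s (cond_cost b + 1 + m + n) s''"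

inductive_cases exec_SkipE: "exec w Skip s n t"
inductive_cases exec_AssignE: "exec w (Assign r e) s n t"
inductive_cases exec_WriteE: "exec w (Write a i e) s n t"
inductive_cases exec_SeqE: "exec w (Seq c d) s n t"
inductive_cases exec_IteE: "exec w (Ite b c d) s n t"
inductive_cases exec_WhileE: "exec w (While b c) s n t"

lemma exec_deterministic:
  "exec w c s m t \<Longrightarrow> exec w c s n u \<Longrightarrow> n = m \<and> u = t"
proof (induction arbitrary: n u rule: exec.induct)
  case Skip then show ?case by (auto elim: exec_SkipE)
next
  case Assign then show ?case by (auto elim: exec_AssignE)
next
  case Write then show ?case by (auto elim: exec_WriteE)
next
  case (Seq c s m s' d n' s'')
  from Seq.prems obtain i j v where "exec w c s i v" "exec w d v j u" "n = i + j"
    by (auto elim: exec_SeqE)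
  with Seq.IH show ?case by metis
next
  case (IteTrue s b c n' s' d)
  from IteTrue.prems IteTrue.hyps(1) obtain i where "exec w c s i u" "n = cond_cost b + 1 + i"
    by (auto elim: exec_IteE)
  with IteTrue.IH show ?case by metis
next
  case (IteFalse s b d n' s' c)
  from IteFalse.prems IteFalse.hyps(1) obtain i where "exec w d s i u" "n = cond_cost b + 1 + i"
    by (auto elim: exec_IteE)
  with IteFalse.IH show ?case by metis
next
  case WhileFalse then show ?case by (auto elim: exec_WhileE)
next
  case (WhileTrue s b c m s' n' s'')
  from WhileTrue.prems WhileTrue.hyps(1) obtain i j v
    where "exec w c s i v" "exec w (While b c) v j u" "n = cond_cost b + 1 + i + j"
    by (auto elim: exec_WhileE)
  with WhileTrue.IH show ?case by metis
qed

text \<open>The input is stored in array \<open>0\<close>, the output is expected in array \<open>1\<close>.\<close>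

definition init_state :: "nat list \<Rightarrow> state" where
  "init_state xs = (\<lambda>r. 0, \<lambda>a i. if a = 0 \<and> i < length xs then xs ! i else 0)"

definition has_output :: "state \<Rightarrow> nat list \<Rightarrow> bool" where
  "has_output s ys \<longleftrightarrow> (\<forall>i<length ys. snd s 1 i = ys ! i)"

text \<open>
  The usual word-size assumption: every input word fits into \<open>w\<close> bits, and
  \<open>w \<ge> k * log 2 N\<close> for inputs of \<open>N\<close> words, where \<open>k\<close> is a constant belonging to the program.
\<close>

definition word_size_ok :: "nat \<Rightarrow> nat \<Rightarrow> nat list \<Rightarrow> bool" where
  "word_size_ok k w xs \<longleftrightarrow> (\<forall>x\<in>set xs. x < 2 ^ w) \<and> length xs ^ k \<le> 2 ^ w"

text \<open>
  A problem is given by the relation \<open>enc xs I\<close> (the word list \<open>xs\<close> encodes the instance \<open>I\<close>) and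
  the relation \<open>ans I ys\<close> (the word list \<open>ys\<close> is a correct answer for \<open>I\<close>). The size of the input is the
  number of words of its encoding.
\<close>

definition solvable_in_time ::
    "(nat list \<Rightarrow> 'i \<Rightarrow> bool) \<Rightarrow> ('i \<Rightarrow> nat list \<Rightarrow> bool) \<Rightarrow> (nat \<Rightarrow> real) \<Rightarrow> bool" where
  "solvable_in_time enc ans f \<longleftrightarrow>
     (\<exists>P k T. T \<in> O(f) \<and>
        (\<forall>I xs w. enc xs I \<longrightarrow> word_size_ok k w xs \<longrightarrow>
           (\<exists>\<tau> s ys. exec w P (init_state xs) \<tau> s \<and> real \<tau> \<le> T (length xs) \<and>
              has_output s ys \<and> ans I ys)))"


section \<open>The problem ConsCheck: Split Graph\<close>

text \<open>
  The vertices are arbitrary natural numbers. The vertex set and the edge sets are given as lists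
  without repetitions, each preceded by its length; every edge is given by its two endpoints, in
  either order.
\<close>

definition edge_of :: "nat \<times> nat \<Rightarrow> nat set" where
  "edge_of p = {fst p, snd p}"

definition sample_words :: "(nat \<times> nat) list \<times> bool \<Rightarrow> nat list" where
  "sample_words p =
     of_bool (snd p) # length (fst p) # concat (map (\<lambda>(u, v). [u, v]) (fst p))"

definition instance_words :: "nat list \<Rightarrow> ((nat \<times> nat) list \<times> bool) list \<Rightarrow> nat list" where
  "instance_words vs ps = length vs # vs @ length ps # concat (map sample_words ps)"

definition conscheck_split_input ::
    "nat list \<Rightarrow> nat set \<times> (nat set set \<times> bool) list \<Rightarrow> bool" where
  "conscheck_split_input xs = (\<lambda>(V, S).
     split_instance V S \<and>
     (\<exists>vs ps. distinct vs \<and> set vs = V \<and>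
        (\<forall>(es, l)\<in>set ps. distinct (map edge_of es)) \<and>
        S = map (\<lambda>(es, l). (edge_of ` set es, l)) ps \<and>
        xs = instance_words vs ps))"

text \<open>The answer \<open>0\<close> reports that there is no consistent set; otherwise a consistent set is listed.\<close>

definition conscheck_split_answer ::
    "nat set \<times> (nat set set \<times> bool) list \<Rightarrow> nat list \<Rightarrow> bool" where
  "conscheck_split_answer = (\<lambda>(V, S) ys.
     (ys = [0] \<and> \<not> (\<exists>X. split_consistent V S X)) \<or>
     (\<exists>zs. ys = 1 # length zs # zs \<and> distinct zs \<and> split_consistent V S (set zs)))"

end

theory Submission imports Defs begin

text \<open>
  Decide for one vertex after the other on which side of the split it lies, backtracking as soon as
  the sides of the first \<open>k\<close> vertices are not a split of the subgraph they induce in some positive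
  sample, or if all vertices are placed and give a split of some negative sample. A split of the
  first \<open>k\<close> vertices can be extended in both ways only if its clique is the neighbourhood of the next
  vertex, so a graph has at most \<open>k + 1\<close> splits on its first \<open>k\<close> vertices. Hence there are at most
  \<open>2 (n + 1)\<^sup>2\<close> dead ends if there is a positive sample, and otherwise every dead end is one of at most
  \<open>t (n + 1)\<close> splits of negative samples. Every descent puts a vertex on the independent side and
  every backtracking step removes one from it, so the number of steps is at most twice the number of
  dead ends plus \<open>n + 1\<close>. One step takes linear time: as edges are not repeated, \<open>X\<close> is a clique iff
  \<open>|X| (|X| - 1) / 2\<close> edges lie inside \<open>X\<close>.
\<close>

section \<open>Weakest preconditions with a clock\<close>

definition wp :: "nat \<Rightarrow> com \<Rightarrow> (state \<Rightarrow> nat \<Rightarrow> bool) \<Rightarrow> state \<Rightarrow> nat \<Rightarrow> bool" where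
  "wp w c Q s \<tau> \<longleftrightarrow> (\<exists>\<sigma> s'. exec w c s \<sigma> s' \<and> Q s' (\<tau> + \<sigma>))"

lemma wp_mono:
  assumes "wp w c Q s \<tau>" and "\<And>s \<tau>. Q s \<tau> \<Longrightarrow> Q' s \<tau>"
  shows "wp w c Q' s \<tau>"
  using assms unfolding wp_def by blast

lemma wp_Skip [simp]: "wp w Skip Q s \<tau> \<longleftrightarrow> Q s (Suc \<tau>)"
  unfolding wp_def by (metis exec_SkipE exec.Skip Suc_eq_plus1)

lemma wp_Assign [simp]:
  "wp w (Assign r e) Q s \<tau> \<longleftrightarrow>
     Q ((fst s)(r := exp_val w s e), snd s) (\<tau> + (exp_cost e + 1))"
  unfolding wp_def by (metis exec_AssignE exec.Assign)

lemma wp_Write [simp]: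
  "wp w (Write a i e) Q s \<tau> \<longleftrightarrow>
     Q (fst s, (snd s)(a := (snd s a)(exp_val w s i := exp_val w s e)))
       (\<tau> + (exp_cost i + exp_cost e + 1))"
  unfolding wp_def by (metis exec_WriteE exec.Write)

lemma wp_Seq [simp]: "wp w (Seq c d) Q s \<tau> \<longleftrightarrow> wp w c (wp w d Q) s \<tau>"
proof
  assume "wp w (Seq c d) Q s \<tau>"
  then show "wp w c (wp w d Q) s \<tau>"
    unfolding wp_def by (metis exec_SeqE add.assoc)
next
  assume "wp w c (wp w d Q) s \<tau>"
  then show "wp w (Seq c d) Q s \<tau>"
    unfolding wp_def by (metis exec.Seq add.assoc)
qed

lemma wp_Ite [simp]:
  "wp w (Ite b c d) Q s \<tau> \<longleftrightarrow>
     (if cond_val w s b then wp w c Q s (\<tau> + (cond_cost b + 1))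
      else wp w d Q s (\<tau> + (cond_cost b + 1)))"
proof (cases "cond_val w s b")
  case True
  then show ?thesis unfolding wp_def
    by (auto elim!: exec_IteE simp: add.assoc) (metis exec.IteTrue add_Suc_right add.commute add.left_commute plus_1_eq_Suc)+
next
  case False
  then show ?thesis unfolding wp_def
    by (auto elim!: exec_IteE simp: add.assoc) (metis exec.IteFalse add_Suc_right add.commute add.left_commute plus_1_eq_Suc)+
qed

lemma wp_While_unfold:
  assumes "if cond_val w s b then wp w c (wp w (While b c) Q) s (\<tau> + (cond_cost b + 1))
           else Q s (\<tau> + (cond_cost b + 1))"
  shows "wp w (While b c) Q s \<tau>"
proof (cases "cond_val w s b")
  case True
  with assms obtain m s' n s'' where
    "exec w c s m s'" "exec w (While b c) s' n s''" "Q s'' (\<tau> + (cond_cost b + 1) + m + n)"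
    unfolding wp_def by auto
  with True show ?thesis
    unfolding wp_def using exec.WhileTrue[of w s b c m s' n s'']
    by (intro exI[of _ "cond_cost b + 1 + m + n"] exI[of _ s'']) (simp add: add.assoc)
next
  case False
  with assms show ?thesis
    unfolding wp_def using exec.WhileFalse[of w s b c]
    by (intro exI[of _ "cond_cost b + 1"] exI[of _ s]) simp
qed

text \<open>The first argument of the invariant is a ghost variable that bounds the remaining iterations.\<close>

lemma wp_While:
  fixes f :: nat
  assumes "I f s \<tau>"
    and "\<And>f s \<tau>. I f s \<tau> \<Longrightarrow> cond_val w s b \<Longrightarrow>
           wp w c (\<lambda>s' \<tau>'. \<exists>f'<f. I f' s' \<tau>') s (\<tau> + (cond_cost b + 1))"
    and "\<And>f s \<tau>. I f s \<tau> \<Longrightarrow> \<not> cond_val w s b \<Longrightarrow> Q s (\<tau> + (cond_cost b + 1))"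
  shows "wp w (While b c) Q s \<tau>"
  using assms(1)
proof (induction f arbitrary: s \<tau> rule: less_induct)
  case (less f)
  show ?case
  proof (rule wp_While_unfold, split if_split, intro conjI impI)
    assume "cond_val w s b"
    from assms(2)[OF less.prems this]
    show "wp w c (wp w (While b c) Q) s (\<tau> + (cond_cost b + 1))"
      by (rule wp_mono) (use less.IH in blast)
  qed (use assms(3) less.prems in blast)
qed

lemma wp_for:
  assumes "I 0 s \<tau>"
    and "\<And>j s \<tau>. j \<le> m \<Longrightarrow> I j s \<tau> \<Longrightarrow> cond_val w s b \<longleftrightarrow> j < m"
    and "\<And>j s \<tau>. j < m \<Longrightarrow> I j s \<tau> \<Longrightarrow> wp w c (I (Suc j)) s (\<tau> + (cond_cost b + 1))"
    and "\<And>s \<tau>. I m s \<tau> \<Longrightarrow> Q s (\<tau> + (cond_cost b + 1))"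
  shows "wp w (While b c) Q s \<tau>"
proof (rule wp_While[where I = "\<lambda>f s \<tau>. f \<le> m \<and> I (m - f) s \<tau>" and f = m])
  fix f s \<tau>
  assume I: "f \<le> m \<and> I (m - f) s \<tau>"
  {
    assume "cond_val w s b"
    then have "m - f < m" using assms(2)[of "m - f" s \<tau>] I by simp
    then have "wp w c (I (Suc (m - f))) s (\<tau> + (cond_cost b + 1))"
      using assms(3) I by blast
    then show "wp w c (\<lambda>s' \<tau>'. \<exists>f'<f. f' \<le> m \<and> I (m - f') s' \<tau>') s (\<tau> + (cond_cost b + 1))"
    proof (rule wp_mono)
      fix s \<tau> assume "I (Suc (m - f)) s \<tau>"
      with \<open>m - f < m\<close> I show "\<exists>f'<f. f' \<le> m \<and> I (m - f') s \<tau>"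
        by (intro exI[of _ "f - 1"]) (auto simp: Suc_diff_le)
    qed
  next
    assume "\<not> cond_val w s b"
    then have "f = 0" using assms(2)[of "m - f" s \<tau>] I by auto
    then show "Q s (\<tau> + (cond_cost b + 1))" using assms(4) I by simp
  }
qed (use assms(1) in simp)


section \<open>Backtracking over subsets of an initial segment\<close>

text \<open>
  A node \<open>(k, X)\<close> with \<open>X \<subseteq> {..<k}\<close> of the search tree stands for all \<open>Z \<subseteq> {..<n}\<close> with
  \<open>Z \<inter> {..<k} = X\<close>. The search goes from left to right, where \<open>k \<notin> Z\<close> is left of \<open>k \<in> Z\<close>.
\<close>

definition extending :: "nat \<Rightarrow> nat \<Rightarrow> nat set \<Rightarrow> nat set set" where
  "extending n k X = {Z. Z \<subseteq> {..<n} \<and> Z \<inter> {..<k} = X}"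

definition left_of :: "nat \<Rightarrow> nat \<Rightarrow> nat set \<Rightarrow> nat set set" where
  "left_of n k X =
     {Z. Z \<subseteq> {..<n} \<and> (\<exists>j<k. j \<in> X \<and> j \<notin> Z \<and> Z \<inter> {..<j} = X \<inter> {..<j})}"

lemma left_of_0 [simp]: "left_of n 0 X = {}"
  by (simp add: left_of_def)

lemma extending_0 [simp]: "extending n 0 {} = Pow {..<n}"
  by (auto simp: extending_def)

lemma left_of_Suc: "X \<subseteq> {..<k} \<Longrightarrow> left_of n (Suc k) X = left_of n k X"
  by (auto simp: left_of_def less_Suc_eq)

lemma not_left_of_self: "X \<notin> left_of n k X"
  by (auto simp: left_of_def)

lemma left_of_Suc_mem:
  assumes "k \<in> X"
  shows "left_of n (Suc k) X = left_of n k (X - {k}) \<union>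
    {Z. Z \<subseteq> {..<n} \<and> k \<notin> Z \<and> Z \<inter> {..<k} = X \<inter> {..<k}}"
proof -
  have "(X - {k}) \<inter> {..<j} = X \<inter> {..<j}" if "j < k" for j using that by auto
  then show ?thesis using assms by (auto simp: left_of_def less_Suc_eq)
qed

lemma extending_Suc_mem:
  assumes "k \<in> X" "X \<subseteq> {..<Suc k}"
  shows "extending n (Suc k) X = {Z. Z \<subseteq> {..<n} \<and> k \<in> Z \<and> Z \<inter> {..<k} = X \<inter> {..<k}}"
  using assms by (auto simp: extending_def lessThan_Suc)

lemma extending_Suc_not_mem:
  assumes "k \<notin> X" "X \<subseteq> {..<Suc k}"
  shows "extending n (Suc k) X = {Z. Z \<subseteq> {..<n} \<and> k \<notin> Z \<and> Z \<inter> {..<k} = X \<inter> {..<k}}"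
  using assms by (auto simp: extending_def lessThan_Suc)

lemma left_of_extending_pop:
  assumes "k \<in> X" "X \<subseteq> {..<Suc k}"
  shows "left_of n (Suc k) X \<union> extending n (Suc k) X =
         left_of n k (X - {k}) \<union> extending n k (X - {k})"
proof -
  have "X - {k} = X \<inter> {..<k}" using assms by (auto simp: lessThan_Suc)
  then have "extending n k (X - {k}) = {Z. Z \<subseteq> {..<n} \<and> Z \<inter> {..<k} = X \<inter> {..<k}}"
    by (simp add: extending_def)
  then show ?thesis
    unfolding left_of_Suc_mem[OF assms(1)] extending_Suc_mem[OF assms] by blast
qed

lemma left_of_flip:
  assumes "k \<notin> X" "X \<subseteq> {..<Suc k}"
  shows "left_of n (Suc k) (insert k X) = left_of n (Suc k) X \<union> extending n (Suc k) X"
proof -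
  have X: "X \<subseteq> {..<k}" using assms by (auto simp: lessThan_Suc)
  have "insert k X - {k} = X" "insert k X \<inter> {..<k} = X \<inter> {..<k}" using assms by auto
  then show ?thesis
    using left_of_Suc_mem[of k "insert k X" n]
    unfolding extending_Suc_not_mem[OF assms] left_of_Suc[OF X] by simp
qed

text \<open>The nodes from which a search that visits only nodes with \<open>ok\<close> ancestors has to turn back.\<close>

definition dead_ends :: "nat \<Rightarrow> (nat \<Rightarrow> nat set \<Rightarrow> bool) \<Rightarrow> (nat \<times> nat set) set" where
  "dead_ends n ok =
     {(k, X). k \<le> n \<and> X \<subseteq> {..<k} \<and> \<not> ok k X \<and> (\<forall>i<k. ok i (X \<inter> {..<i}))}"

lemma finite_dead_ends: "finite (dead_ends n ok)"
  by (rule finite_subset[of _ "{..n} \<times> Pow {..<n}"]) (auto simp: dead_ends_def)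

definition search_inv ::
    "nat \<Rightarrow> (nat \<Rightarrow> nat set \<Rightarrow> bool) \<Rightarrow> (nat \<times> nat set) set \<Rightarrow> nat \<Rightarrow> nat set \<Rightarrow> bool" where
  "search_inv n ok D k X \<longleftrightarrow>
     k \<le> n \<and> X \<subseteq> {..<k} \<and> (\<forall>i<k. ok i (X \<inter> {..<i})) \<and> D \<subseteq> dead_ends n ok \<and>
     snd ` D \<subseteq> left_of n k X \<and> (\<forall>Z\<in>left_of n k X. \<not> ok n Z)"

lemma search_inv_start: "search_inv n ok {} 0 {}"
  by (simp add: search_inv_def)

lemma search_inv_descend:
  assumes "search_inv n ok D k X" "ok k X" "k < n"
  shows "search_inv n ok D (Suc k) X"
proof -
  have X: "X \<subseteq> {..<k}" using assms by (simp add: search_inv_def)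
  then have "X \<inter> {..<k} = X" by blast
  with assms X show ?thesis
    by (auto simp: search_inv_def left_of_Suc less_Suc_eq)
qed

definition backtrack_inv ::
    "nat \<Rightarrow> (nat \<Rightarrow> nat set \<Rightarrow> bool) \<Rightarrow> (nat \<times> nat set) set \<Rightarrow> nat \<Rightarrow> nat set \<Rightarrow> bool" where
  "backtrack_inv n ok D k X \<longleftrightarrow>
     k \<le> n \<and> X \<subseteq> {..<k} \<and> (\<forall>i<k. ok i (X \<inter> {..<i})) \<and> D \<subseteq> dead_ends n ok \<and>
     snd ` D \<subseteq> left_of n k X \<union> extending n k X \<and>
     (\<forall>Z\<in>left_of n k X \<union> extending n k X. \<not> ok n Z)"

lemma backtrack_inv_start:
  assumes inv: "search_inv n ok D k X" and "\<not> ok k X"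
    and hereditary: "\<And>k Z. ok n Z \<Longrightarrow> Z \<subseteq> {..<n} \<Longrightarrow> k \<le> n \<Longrightarrow> ok k (Z \<inter> {..<k})"
  shows "backtrack_inv n ok (insert (k, X) D) k X" and "(k, X) \<notin> D"
proof -
  have "X \<in> extending n k X" "(k, X) \<in> dead_ends n ok"
    using assms by (auto simp: extending_def dead_ends_def search_inv_def)
  moreover have "\<not> ok n Z" if "Z \<in> extending n k X" for Z
    using hereditary[of Z k] that inv \<open>\<not> ok k X\<close> by (auto simp: extending_def search_inv_def)
  ultimately show "backtrack_inv n ok (insert (k, X) D) k X"
    using inv unfolding backtrack_inv_def search_inv_def by auto
  show "(k, X) \<notin> D"
    using inv not_left_of_self[of X n k] unfolding search_inv_def by (metis image_subset_iff snd_conv)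
qed

lemma backtrack_inv_pop:
  assumes "backtrack_inv n ok D (Suc k) X" "k \<in> X"
  shows "backtrack_inv n ok D k (X - {k})"
proof -
  have X: "X \<subseteq> {..<Suc k}" using assms by (simp add: backtrack_inv_def)
  moreover have "(X - {k}) \<inter> {..<i} = X \<inter> {..<i}" if "i < k" for i using that by auto
  ultimately show ?thesis
    using assms left_of_extending_pop[OF assms(2) X, of n]
    by (auto simp: backtrack_inv_def lessThan_Suc)
qed

lemma backtrack_inv_flip:
  assumes "backtrack_inv n ok D (Suc k) X" "k \<notin> X"
  shows "search_inv n ok D (Suc k) (insert k X)"
proof -
  have X: "X \<subseteq> {..<Suc k}" using assms by (simp add: backtrack_inv_def)
  moreover have "insert k X \<inter> {..<i} = X \<inter> {..<i}" if "i < Suc k" for i using that by auto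
  ultimately show ?thesis
    using assms left_of_flip[OF assms(2) X, of n]
    by (simp add: backtrack_inv_def search_inv_def)
qed

lemma backtrack_inv_exhausted:
  assumes "backtrack_inv n ok D 0 X" "Z \<subseteq> {..<n}"
  shows "\<not> ok n Z"
  using assms by (auto simp: backtrack_inv_def)


section \<open>Counting splits\<close>

definition initial_split :: "nat list \<Rightarrow> nat set set \<Rightarrow> nat \<Rightarrow> nat set \<Rightarrow> bool" where
  "initial_split vs E k X \<longleftrightarrow>
     clique E ((!) vs ` X) \<and> independent_set E ((!) vs ` ({..<k} - X))"

lemma initial_split_restrict:
  assumes "initial_split vs E n Z" "k \<le> n"
  shows "initial_split vs E k (Z \<inter> {..<k})"
proof -
  have "{..<k} - Z \<inter> {..<k} \<subseteq> {..<n} - Z" using assms(2) by auto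
  with assms(1) show ?thesis
    unfolding initial_split_def clique_def independent_set_def by blast
qed

text \<open>
  At most one split of the first \<open>k\<close> vertices extends in both ways to the next vertex, namely the
  one whose clique consists of the neighbours of that vertex.
\<close>

lemma card_initial_splits:
  assumes "distinct vs" "k \<le> length vs"
  shows "card {X. X \<subseteq> {..<k} \<and> initial_split vs E k X} \<le> Suc k"
  using assms(2)
proof (induction k)
  case 0
  have "{X. X \<subseteq> {..<0::nat} \<and> initial_split vs E 0 X} \<subseteq> {{}}" by auto
  then show ?case using card_mono[of "{{}}" "{X. X \<subseteq> {..<0::nat} \<and> initial_split vs E 0 X}"]
    by simp
next
  case (Suc k)
  define S where "S k = {X. X \<subseteq> {..<k} \<and> initial_split vs E k X}" for k
  define A where "A = {X \<in> S (Suc k). k \<notin> X}"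
  define B where "B = {X \<in> S (Suc k). k \<in> X}"
  define B' where "B' = (\<lambda>X. X - {k}) ` B"
  have fin: "finite (S m)" for m
    by (rule finite_subset[of _ "Pow {..<m}"]) (auto simp: S_def)
  have restrict: "X \<inter> {..<k} \<in> S k" if "X \<in> S (Suc k)" for X
    using that initial_split_restrict[of vs E "Suc k" X k] by (auto simp: S_def)
  have A: "A \<subseteq> S k"
  proof
    fix X assume X: "X \<in> A"
    then have "X \<inter> {..<k} = X" by (auto simp: A_def S_def lessThan_Suc)
    with restrict[of X] X show "X \<in> S k" by (simp add: A_def)
  qed
  have B': "B' \<subseteq> S k"
  proof
    fix Y assume "Y \<in> B'"
    then obtain X where X: "X \<in> B" "Y = X - {k}" by (auto simp: B'_def)
    then have "Y = X \<inter> {..<k}" by (auto simp: B_def S_def lessThan_Suc)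
    with restrict[of X] X show "Y \<in> S k" by (simp add: B_def)
  qed
  have nth_neq: "vs ! i \<noteq> vs ! k" if "i < k" for i
    using that assms(1) Suc.prems by (simp add: nth_eq_iff_index_eq)
  have "A \<inter> B' \<subseteq> {{i \<in> {..<k}. {vs ! k, vs ! i} \<in> E}}"
  proof
    fix X assume X: "X \<in> A \<inter> B'"
    then have sub: "X \<subseteq> {..<k}" using A by (auto simp: S_def)
    have "{vs ! k, vs ! i} \<in> E \<longleftrightarrow> i \<in> X" if i: "i < k" for i
    proof
      assume "i \<in> X"
      moreover from X obtain Y where "Y \<in> B" "X = Y - {k}" by (auto simp: B'_def)
      ultimately show "{vs ! k, vs ! i} \<in> E"
        using nth_neq[OF i] by (auto simp: B_def S_def initial_split_def clique_def)
    next
      assume "{vs ! k, vs ! i} \<in> E"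
      moreover from X have "independent_set E ((!) vs ` ({..<Suc k} - X))" "k \<notin> X"
        by (auto simp: A_def S_def initial_split_def)
      moreover have "vs ! i \<in> (!) vs ` ({..<Suc k} - X)" if "i \<notin> X" using that i by simp
      ultimately show "i \<in> X"
        using nth_neq[OF i] unfolding independent_set_def by fastforce
    qed
    with sub show "X \<in> {{i \<in> {..<k}. {vs ! k, vs ! i} \<in> E}}" by auto
  qed
  then have "card (A \<inter> B') \<le> 1"
    using card_mono[of "{{i \<in> {..<k}. {vs ! k, vs ! i} \<in> E}}"] by simp
  moreover have "card (A \<union> B') \<le> Suc k"
    using card_mono[OF fin, of "A \<union> B'" k] A B' Suc by (simp add: S_def)
  moreover have "card A + card B' = card (A \<union> B') + card (A \<inter> B')"
    using A B' fin by (intro card_Un_Int) (auto intro: finite_subset)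
  moreover have "card B' = card B"
    unfolding B'_def by (intro card_image inj_onI) (auto simp: B_def)
  moreover have "card (S (Suc k)) \<le> card A + card B"
  proof -
    have "S (Suc k) = A \<union> B" by (auto simp: A_def B_def)
    then show ?thesis by (simp add: card_Un_le)
  qed
  ultimately show ?case by (simp add: S_def)
qed

definition sample_ok :: "nat list \<Rightarrow> nat \<Rightarrow> nat set \<Rightarrow> nat set set \<times> bool \<Rightarrow> bool" where
  "sample_ok vs k X p \<longleftrightarrow>
     (if snd p then initial_split vs (fst p) k X
      else k = length vs \<longrightarrow> \<not> initial_split vs (fst p) k X)"

lemma sample_ok_restrict:
  assumes "sample_ok vs (length vs) Z p" "Z \<subseteq> {..<length vs}" "k \<le> length vs"
  shows "sample_ok vs k (Z \<inter> {..<k}) p"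
  using assms initial_split_restrict[of vs "fst p" "length vs" Z k]
  by (auto simp: sample_ok_def Int_absorb2)

lemma card_dead_ends_positive:
  assumes "distinct vs" "(E, True) \<in> set S"
  shows "card (dead_ends (length vs) (\<lambda>k X. \<forall>p\<in>set S. sample_ok vs k X p))
    \<le> 2 * Suc (length vs) ^ 2" (is "card ?D \<le> _")
proof -
  define n where "n = length vs"
  define F where "F k = {X. X \<subseteq> {..<k} \<and> initial_split vs E k X}" for k
  define f :: "nat \<times> nat set \<Rightarrow> nat \<times> nat set \<times> bool"
    where "f = (\<lambda>(k, X). (k, X \<inter> {..<k - 1}, k - 1 \<in> X))"
  have fin: "finite (F k)" for k
    by (rule finite_subset[of _ "Pow {..<k}"]) (auto simp: F_def)
  have F0: "F 0 = {{}}"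
    by (auto simp: F_def initial_split_def clique_def independent_set_def)
  have img: "f ` ?D \<subseteq> Sigma {..n} (\<lambda>k. F (k - 1) \<times> (UNIV :: bool set))"
  proof
    fix y assume "y \<in> f ` ?D"
    then obtain k X where y: "y = f (k, X)" and kX: "(k, X) \<in> ?D" by auto
    have "X \<inter> {..<k - 1} \<in> F (k - 1)"
    proof (cases k)
      case 0
      then show ?thesis by (simp add: F0)
    next
      case (Suc m)
      then have "sample_ok vs m (X \<inter> {..<m}) (E, True)"
        using kX assms(2) by (auto simp: dead_ends_def)
      then show ?thesis by (simp add: F_def sample_ok_def Suc)
    qed
    with kX show "y \<in> Sigma {..n} (\<lambda>k. F (k - 1) \<times> (UNIV :: bool set))"
      by (auto simp: y f_def dead_ends_def n_def)
  qed
  have inj: "inj_on f ?D"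
  proof (rule inj_onI, clarify)
    fix k X l Y
    assume kX: "(k, X) \<in> ?D" and lY: "(l, Y) \<in> ?D" and eq: "f (k, X) = f (l, Y)"
    then have "l = k" and eq: "X \<inter> {..<k - 1} = Y \<inter> {..<k - 1}" "k - 1 \<in> X \<longleftrightarrow> k - 1 \<in> Y"
      by (auto simp: f_def)
    moreover have sub: "X \<subseteq> {..<k}" "Y \<subseteq> {..<k}"
      using kX lY \<open>l = k\<close> by (auto simp: dead_ends_def)
    have "i \<in> X \<longleftrightarrow> i \<in> Y" for i
    proof (cases "i < k - 1")
      case True
      then show ?thesis using eq(1) by blast
    next
      case False
      then have "i = k - 1 \<or> \<not> i < k" by linarith
      then show ?thesis using eq(2) sub by auto
    qed
    ultimately show "k = l \<and> X = Y" by blast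
  qed
  have "card ?D \<le> card (Sigma {..n} (\<lambda>k. F (k - 1) \<times> (UNIV :: bool set)))"
    using fin by (intro card_inj_on_le[OF inj img]) auto
  also have "\<dots> = (\<Sum>k\<le>n. card (F (k - 1)) * 2)"
    using fin by (subst card_SigmaI) (auto simp: card_cartesian_product)
  also have "\<dots> \<le> (\<Sum>k\<le>n. Suc n * 2)"
  proof (intro sum_mono mult_right_mono)
    fix k assume "k \<in> {..n}"
    then have "card (F (k - 1)) \<le> Suc (k - 1)"
      unfolding F_def by (intro card_initial_splits assms(1)) (auto simp: n_def)
    with \<open>k \<in> {..n}\<close> show "card (F (k - 1)) \<le> Suc n" by auto
  qed simp
  finally show ?thesis by (simp add: n_def power2_eq_square algebra_simps)
qed

lemma card_dead_ends_negative:
  assumes "distinct vs" "\<forall>p\<in>set S. \<not> snd p"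
  shows "card (dead_ends (length vs) (\<lambda>k X. \<forall>p\<in>set S. sample_ok vs k X p))
    \<le> length S * Suc (length vs)" (is "card ?D \<le> _")
proof -
  define F where "F p = {X. X \<subseteq> {..<length vs} \<and> initial_split vs (fst p) (length vs) X}"
    for p :: "nat set set \<times> bool"
  have fin: "finite (F p)" for p
    by (rule finite_subset[of _ "Pow {..<length vs}"]) (auto simp: F_def)
  have "?D \<subseteq> Pair (length vs) ` (\<Union>p\<in>set S. F p)"
    using assms(2) by (auto simp: dead_ends_def sample_ok_def F_def image_iff split: if_splits)
  then have "card ?D \<le> card (\<Union>p\<in>set S. F p)"
    using fin by (intro surj_card_le) auto
  also have "\<dots> \<le> (\<Sum>p\<in>set S. card (F p))"
    by (rule card_UN_le) simp
  also have "\<dots> \<le> (\<Sum>p\<in>set S. Suc (length vs))"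
    unfolding F_def by (intro sum_mono card_initial_splits assms(1)) simp
  also have "\<dots> \<le> length S * Suc (length vs)"
    using card_length[of S] by (simp only: sum_constant of_nat_id mult_right_mono)
  finally show ?thesis .
qed

lemma card_dead_ends:
  assumes "distinct vs"
  shows "card (dead_ends (length vs) (\<lambda>k X. \<forall>p\<in>set S. sample_ok vs k X p))
    \<le> 2 * Suc (length vs) ^ 2 + length S * Suc (length vs)"
proof (cases "\<exists>E. (E, True) \<in> set S")
  case True
  then show ?thesis using card_dead_ends_positive[OF assms, of _ S] by fastforce
next
  case False
  then have "\<forall>p\<in>set S. \<not> snd p" by auto
  then show ?thesis using card_dead_ends_negative[OF assms, of S] by linarith
qed

lemma clique_iff_card:
  assumes "finite X" "\<forall>e\<in>E. card e = 2"
  shows "clique E X \<longleftrightarrow> card {e \<in> E. e \<subseteq> X} = card X choose 2"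
proof -
  let ?P = "{e. e \<subseteq> X \<and> card e = 2}"
  have fin: "finite ?P" using assms(1) by simp
  have sub: "{e \<in> E. e \<subseteq> X} \<subseteq> ?P" using assms(2) by auto
  have card: "card ?P = card X choose 2" using n_subsets[OF assms(1)] by simp
  have "clique E X \<longleftrightarrow> {e \<in> E. e \<subseteq> X} = ?P"
  proof
    assume "clique E X"
    then have "e \<in> E" if "e \<subseteq> X" "card e = 2" for e
      using that unfolding card_2_iff clique_def by blast
    with sub show "{e \<in> E. e \<subseteq> X} = ?P" by blast
  next
    assume eq: "{e \<in> E. e \<subseteq> X} = ?P"
    show "clique E X" unfolding clique_def
    proof (intro ballI impI)
      fix u v assume "u \<in> X" "v \<in> X" "u \<noteq> v"
      then have "{u, v} \<in> ?P" by simp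
      with eq show "{u, v} \<in> E" by blast
    qed
  qed
  also have "\<dots> \<longleftrightarrow> card {e \<in> E. e \<subseteq> X} = card X choose 2"
    using card_subset_eq[OF fin sub] card by auto
  finally show ?thesis .
qed

lemma independent_set_iff_card:
  assumes "finite E" "\<forall>e\<in>E. card e = 2"
  shows "independent_set E Y \<longleftrightarrow> card {e \<in> E. e \<subseteq> Y} = 0"
proof -
  have "independent_set E Y \<longleftrightarrow> {e \<in> E. e \<subseteq> Y} = {}"
    using assms(2) unfolding independent_set_def card_2_iff by fastforce
  then show ?thesis using assms(1) by simp
qed

lemma choose_two_Suc: "Suc p choose 2 = p + (p choose 2)"
  by (simp add: numeral_2_eq_2)

lemma choose_two_le: "p choose 2 \<le> p * p"
  by (simp add: choose_two div_le_dividend le_trans[OF div_le_dividend])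


section \<open>The program\<close>

text \<open>
  \<open>rRun\<close> is \<open>1\<close> during the search, \<open>2\<close> after success and \<open>0\<close> after failure; \<open>rTri\<close> is \<open>rP choose 2\<close>,
  computed by additions only; \<open>rX\<close> and \<open>rY\<close> count the edges inside the two sides.
\<close>

abbreviation (input) "rN \<equiv> 0 :: nat"
abbreviation (input) "rT \<equiv> 1 :: nat"
abbreviation (input) "rK \<equiv> 2 :: nat"
abbreviation (input) "rRun \<equiv> 3 :: nat"
abbreviation (input) "rBad \<equiv> 4 :: nat"
abbreviation (input) "rP \<equiv> 5 :: nat"
abbreviation (input) "rTri \<equiv> 6 :: nat"
abbreviation (input) "rJ \<equiv> 7 :: nat"
abbreviation (input) "rPos \<equiv> 8 :: nat"
abbreviation (input) "rI \<equiv> 9 :: nat"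
abbreviation (input) "rL \<equiv> 10 :: nat"
abbreviation (input) "rM \<equiv> 11 :: nat"
abbreviation (input) "rX \<equiv> 12 :: nat"
abbreviation (input) "rY \<equiv> 13 :: nat"
abbreviation (input) "rE \<equiv> 14 :: nat"

abbreviation seq :: "com \<Rightarrow> com \<Rightarrow> com" (infixr ";;" 60) where "c ;; d \<equiv> Seq c d"
abbreviation plus_const :: "nat \<Rightarrow> nat \<Rightarrow> exp" where "plus_const r c \<equiv> Add (Reg r) (Const c)"
abbreviation incr :: "nat \<Rightarrow> com" where "incr r \<equiv> Assign r (plus_const r 1)"
abbreviation vertex :: "nat \<Rightarrow> exp" where "vertex r \<equiv> Read 0 (plus_const r 1)"

text \<open>
  Array \<open>2\<close> is indexed by the vertices themselves: it holds \<open>2\<close> for vertices on the clique side,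
  \<open>1\<close> for those on the independent side, and \<open>0\<close> for those not yet assigned.
\<close>

abbreviation side :: "exp \<Rightarrow> exp" where "side e \<equiv> Read 2 e"

definition count_prog :: com where
  "count_prog =
     Assign rP (Const 0) ;; Assign rTri (Const 0) ;; Assign rJ (Const 0) ;;
     While (Less (Reg rJ) (Reg rK))
       (Ite (Equal (side (vertex rJ)) (Const 2))
          (Assign rTri (Add (Reg rTri) (Reg rP)) ;; incr rP)
          Skip ;;
        incr rJ)"

definition edges_prog :: com where
  "edges_prog =
     While (Less (Reg rE) (Reg rM))
       (Ite (Conj (Equal (side (Read 0 (Reg rPos))) (Const 2))
                  (Equal (side (Read 0 (plus_const rPos 1))) (Const 2)))
          (incr rX)
          (Ite (Conj (Equal (side (Read 0 (Reg rPos))) (Const 1))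
                     (Equal (side (Read 0 (plus_const rPos 1))) (Const 1)))
             (incr rY) Skip) ;;
        Assign rPos (plus_const rPos 2) ;;
        incr rE)"

definition sample_prog :: com where
  "sample_prog =
     Assign rL (Read 0 (Reg rPos)) ;;
     Assign rM (Read 0 (plus_const rPos 1)) ;;
     Assign rPos (plus_const rPos 2) ;;
     Assign rX (Const 0) ;; Assign rY (Const 0) ;; Assign rE (Const 0) ;;
     edges_prog ;;
     Ite (Conj (Equal (Reg rX) (Reg rTri)) (Equal (Reg rY) (Const 0)))
       (Ite (Conj (Equal (Reg rL) (Const 0)) (Equal (Reg rK) (Reg rN)))
          (Assign rBad (Const 1)) Skip)
       (Ite (Equal (Reg rL) (Const 1)) (Assign rBad (Const 1)) Skip)"

definition check_prog :: com where
  "check_prog =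
     count_prog ;;
     Assign rBad (Const 0) ;;
     Assign rPos (plus_const rN 2) ;;
     Assign rI (Const 0) ;;
     While (Less (Reg rI) (Reg rT)) (sample_prog ;; incr rI)"

definition backtrack_prog :: com where
  "backtrack_prog =
     While (Conj (Less (Const 0) (Reg rK)) (Equal (side (Read 0 (Reg rK))) (Const 2)))
       (Write 2 (Read 0 (Reg rK)) (Const 0) ;;
        Assign rK (Sub (Reg rK) (Const 1))) ;;
     Ite (Equal (Reg rK) (Const 0))
       (Assign rRun (Const 0))
       (Write 2 (Read 0 (Reg rK)) (Const 2))"

definition search_prog :: com where
  "search_prog =
     While (Equal (Reg rRun) (Const 1))
       (check_prog ;;
        Ite (Equal (Reg rBad) (Const 0))
          (Ite (Less (Reg rK) (Reg rN))
             (incr rK ;; Write 2 (Read 0 (Reg rK)) (Const 1))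
             (Assign rRun (Const 2)))
          backtrack_prog)"

definition output_prog :: com where
  "output_prog =
     Write 1 (Const 0) (Const 1) ;;
     Assign rP (Const 0) ;; Assign rJ (Const 0) ;;
     While (Less (Reg rJ) (Reg rN))
       (Ite (Equal (side (vertex rJ)) (Const 2))
          (Write 1 (plus_const rP 2) (vertex rJ) ;; incr rP)
          Skip ;;
        incr rJ) ;;
     Write 1 (Const 1) (Reg rP)"

definition split_prog :: com where
  "split_prog =
     Assign rN (Read 0 (Const 0)) ;;
     Assign rT (Read 0 (plus_const rN 1)) ;;
     Assign rRun (Const 1) ;;
     search_prog ;;
     Ite (Equal (Reg rRun) (Const 2)) output_prog Skip"

lemma drop_eq_Cons_Cons:
  assumes "drop i zs = a # b # ys"
  shows "zs ! i = a" "zs ! Suc i = b" "Suc (Suc i) \<le> length zs" "drop (Suc (Suc i)) zs = ys"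
proof -
  have "length (drop i zs) \<ge> 2" using assms by simp
  then show "Suc (Suc i) \<le> length zs" by simp
  then have "drop i zs = zs ! i # zs ! Suc i # drop (Suc (Suc i)) zs"
    by (metis Cons_nth_drop_Suc Suc_le_lessD Suc_leD)
  with assms show "zs ! i = a" "zs ! Suc i = b" "drop (Suc (Suc i)) zs = ys" by simp_all
qed

locale split_input =
  fixes w :: nat and vs :: "nat list" and ps :: "((nat \<times> nat) list \<times> bool) list"
  assumes distinct_vs: "distinct vs"
    and distinct_edges: "\<And>es l. (es, l) \<in> set ps \<Longrightarrow> distinct (map edge_of es)"
    and edges_in: "\<And>es l u v. (es, l) \<in> set ps \<Longrightarrow> (u, v) \<in> set es \<Longrightarrow>
                     u \<in> set vs \<and> v \<in> set vs \<and> u \<noteq> v"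
    and word_size: "length (instance_words vs ps) ^ 3 \<le> 2 ^ w"
begin

abbreviation "xs \<equiv> instance_words vs ps"
abbreviation "N \<equiv> length (instance_words vs ps)"
abbreviation "n \<equiv> length vs"

definition samples :: "(nat set set \<times> bool) list" where
  "samples = map (\<lambda>(es, l). (edge_of ` set es, l)) ps"

abbreviation ok :: "nat \<Rightarrow> nat set \<Rightarrow> bool" where
  "ok k X \<equiv> \<forall>p\<in>set samples. sample_ok vs k X p"

definition represents :: "(nat \<Rightarrow> nat \<Rightarrow> nat) \<Rightarrow> nat \<Rightarrow> nat set \<Rightarrow> bool" where
  "represents A k X \<longleftrightarrow>
     A 0 = (\<lambda>i. if i < N then xs ! i else 0) \<and> A 1 = (\<lambda>_. 0) \<and>
     (\<forall>j<n. A 2 (vs ! j) = (if j < k then if j \<in> X then 2 else 1 else 0))"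

lemma n_less_N: "n + 2 \<le> N"
  by (simp add: instance_words_def)

lemma length_ps_less_N: "2 * length ps < N"
proof -
  have "2 * length ps \<le> length (concat (map sample_words ps))"
    by (induction ps) (auto simp: sample_words_def)
  then show ?thesis by (simp add: instance_words_def)
qed

lemma fits_word:
  assumes "i < 2 * N * N"
  shows "i < 2 ^ w"
proof -
  have "2 * (N * N) \<le> N * (N * N)" using n_less_N by (intro mult_right_mono) auto
  also have "\<dots> = N ^ 3" by (simp add: power3_eq_cube mult.assoc)
  finally show ?thesis using assms word_size by simp
qed

lemma fits_word_linear:
  assumes "i < 4 * N"
  shows "i < 2 ^ w"
proof (rule fits_word)
  have "2 * N \<le> N * N" using n_less_N by (intro mult_right_mono) auto
  then show "i < 2 * N * N" using assms unfolding mult.assoc by linarith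
qed

lemma word_consts [simp]: "0 < w" "Suc 0 mod 2 ^ w = Suc 0" "2 mod 2 ^ w = (2::nat)"
proof -
  have "1 < (2::nat) ^ w" "2 < (2::nat) ^ w"
    using n_less_N by (auto intro!: fits_word_linear)
  then show "0 < w" "Suc 0 mod 2 ^ w = Suc 0" "2 mod 2 ^ w = (2::nat)"
    by (cases w; simp)+
qed

lemma read_vertex:
  assumes "represents A k X" "j < n"
  shows "A 0 (Suc j) = vs ! j"
  using assms n_less_N by (auto simp: represents_def instance_words_def nth_append)

lemma wp_count_prog:
  assumes rep: "represents A k X" and "k \<le> n" "X \<subseteq> {..<k}" and K: "R rK = k"
  shows "wp w count_prog (\<lambda>s' \<tau>'. \<exists>R'. s' = (R', A) \<and>
      (\<forall>r. r \<notin> {rP, rTri, rJ} \<longrightarrow> R' r = R r) \<and> R' rTri = card X choose 2 \<and>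
      \<tau>' \<le> \<tau> + 30 * N) (R, A) \<tau>"
proof -
  define I where "I j s \<tau>' \<longleftrightarrow> (\<exists>R'. s = (R', A) \<and>
      (\<forall>r. r \<notin> {rP, rTri, rJ} \<longrightarrow> R' r = R r) \<and> R' rJ = j \<and>
      R' rP = card (X \<inter> {..<j}) \<and> R' rTri = card (X \<inter> {..<j}) choose 2 \<and>
      \<tau>' \<le> \<tau> + 10 + 30 * j)" for j s \<tau>'
  show ?thesis
    unfolding count_prog_def
  proof (simp, rule wp_for[where I = I and m = k], goal_cases)
    case 1
    then show ?case by (simp add: I_def numeral_2_eq_2)
  next
    case (2 j s \<tau>)
    then show ?case using K by (auto simp: I_def)
  next
    case (3 j s \<tau>')
    then obtain R' where s: "s = (R', A)" and frame: "\<forall>r. r \<notin> {rP, rTri, rJ} \<longrightarrow> R' r = R r"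
      and R': "R' rJ = j" "R' rP = card (X \<inter> {..<j})" "R' rTri = card (X \<inter> {..<j}) choose 2"
      and time: "\<tau>' \<le> \<tau> + 10 + 30 * j"
      by (auto simp: I_def)
    have j: "j < n" using 3 \<open>k \<le> n\<close> by simp
    define p where "p = card (X \<inter> {..<j})"
    have p: "p \<le> j" unfolding p_def using card_mono[of "{..<j}" "X \<inter> {..<j}"] by simp
    have "(p choose 2) + p \<le> Suc p * Suc p"
      using choose_two_le[of "Suc p"] choose_two_Suc[of p] by simp
    also have "\<dots> \<le> N * N" using p j n_less_N by (intro mult_le_mono) auto
    also have "\<dots> < 2 * N * N" using n_less_N by auto
    finally have fits: "(p choose 2) + p < 2 ^ w" by (rule fits_word)
    have fits': "Suc p < 2 ^ w" "Suc j < 2 ^ w"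
      using p j n_less_N by (auto intro!: fits_word_linear)
    have side: "A 2 (A 0 (Suc j)) = (if j \<in> X then 2 else 1)"
      using read_vertex[OF rep j] rep j 3 by (simp add: represents_def)
    have step: "card (X \<inter> {..<Suc j}) = (if j \<in> X then Suc p else p)"
      by (auto simp: p_def lessThan_Suc)
    show ?case
      unfolding s using time frame R' fits fits' side step
      by (auto simp: I_def p_def[symmetric] choose_two_Suc)
  next
    case (4 s \<tau>')
    have "X \<inter> {..<k} = X" using \<open>X \<subseteq> {..<k}\<close> by blast
    with 4 show ?case using \<open>k \<le> n\<close> n_less_N by (auto simp: I_def)
  qed
qed

lemma wp_edges_prog:
  assumes A: "represents A k X"
    and edges: "drop pos xs = concat (map (\<lambda>(u, v). [u, v]) es) @ ys" "pos \<le> N"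
    and R: "R rPos = pos" "R rM = length es" "R rX = 0" "R rY = 0" "R rE = 0"
  shows "wp w edges_prog (\<lambda>s' \<tau>'. \<exists>R'. s' = (R', A) \<and>
      (\<forall>r. r \<notin> {rX, rY, rE, rPos} \<longrightarrow> R' r = R r) \<and>
      R' rX = length (filter (\<lambda>(u, v). A 2 u = 2 \<and> A 2 v = 2) es) \<and>
      R' rY = length (filter (\<lambda>(u, v). A 2 u = 1 \<and> A 2 v = 1) es) \<and>
      R' rPos = pos + 2 * length es \<and> pos + 2 * length es \<le> N \<and>
      drop (pos + 2 * length es) xs = ys \<and>
      \<tau>' \<le> \<tau> + 10 + 60 * length es) (R, A) \<tau>"
proof -
  define cnt where "cnt c es = length (filter (\<lambda>(u, v). A 2 u = c \<and> A 2 v = c) es)"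
    for c and es :: "(nat \<times> nat) list"
  define I where "I e s \<tau>' \<longleftrightarrow> (\<exists>R'. s = (R', A) \<and>
      (\<forall>r. r \<notin> {rX, rY, rE, rPos} \<longrightarrow> R' r = R r) \<and> R' rE = e \<and>
      R' rX = cnt 2 (take e es) \<and> R' rY = cnt 1 (take e es) \<and>
      R' rPos = pos + 2 * e \<and> pos + 2 * e \<le> N \<and>
      drop (pos + 2 * e) xs = concat (map (\<lambda>(u, v). [u, v]) (drop e es)) @ ys \<and>
      \<tau>' \<le> \<tau> + 60 * e)" for e s \<tau>'
  show ?thesis
    unfolding edges_prog_def
  proof (rule wp_for[where I = I and m = "length es"], goal_cases)
    case 1
    then show ?case using edges R by (simp add: I_def cnt_def)
  next
    case (2 e s \<tau>)
    then show ?case using R by (auto simp: I_def)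
  next
    case (3 e s \<tau>')
    then obtain R' where s: "s = (R', A)"
      and frame: "\<forall>r. r \<notin> {rX, rY, rE, rPos} \<longrightarrow> R' r = R r"
      and R': "R' rE = e" "R' rX = cnt 2 (take e es)" "R' rY = cnt 1 (take e es)"
        "R' rPos = pos + 2 * e"
      and drop: "drop (pos + 2 * e) xs = concat (map (\<lambda>(u, v). [u, v]) (drop e es)) @ ys"
      and time: "\<tau>' \<le> \<tau> + 60 * e"
      by (auto simp: I_def)
    obtain u v where uv: "es ! e = (u, v)" by fastforce
    have "drop e es = (u, v) # drop (Suc e) es"
      using 3 uv by (metis Cons_nth_drop_Suc)
    with drop have "drop (pos + 2 * e) xs =
        u # v # concat (map (\<lambda>(u, v). [u, v]) (drop (Suc e) es)) @ ys"
      by simp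
    note pos = drop_eq_Cons_Cons[OF this]
    have read: "A 0 (pos + 2 * e) = u" "A 0 (Suc (pos + 2 * e)) = v"
      using A pos(1-3) by (auto simp: represents_def)
    have fits: "Suc (cnt c (take e es)) < 2 ^ w" for c
    proof (rule fits_word_linear)
      have "cnt c (take e es) \<le> length (take e es)"
        unfolding cnt_def by (rule length_filter_le)
      then show "Suc (cnt c (take e es)) < 4 * N" using 3 pos(3) by simp
    qed
    have fits': "Suc e < 2 ^ w" "Suc (pos + 2 * e) < 2 ^ w" "Suc (Suc (pos + 2 * e)) < 2 ^ w"
      using pos(3) n_less_N by (auto intro!: fits_word_linear)
    have step: "cnt c (take (Suc e) es) =
        (if A 2 u = c \<and> A 2 v = c then Suc (cnt c (take e es)) else cnt c (take e es))" for c
      using 3 uv by (simp add: cnt_def take_Suc_conv_app_nth)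
    show ?case
      unfolding s using time frame R' fits[of 1] fits[of 2] fits' read pos(3,4) step
      by (auto simp: I_def)
  next
    case (4 s \<tau>')
    then show ?case by (auto simp: I_def cnt_def)
  qed
qed

lemma count_edges_inside:
  assumes es: "(es, l) \<in> set ps" and Z: "Z \<subseteq> {..<n}"
    and side: "\<And>j. j < n \<Longrightarrow> A (vs ! j) = c \<longleftrightarrow> j \<in> Z"
  shows "length (filter (\<lambda>(u, v). A u = c \<and> A v = c) es) =
    card {e \<in> edge_of ` set es. e \<subseteq> (!) vs ` Z}"
proof -
  let ?P = "\<lambda>(u, v). A u = c \<and> A v = c"
  have mem: "A u = c \<longleftrightarrow> u \<in> (!) vs ` Z" if u: "u \<in> set vs" for u
  proof -
    obtain j where j: "j < n" "u = vs ! j" using u by (metis in_set_conv_nth)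
    moreover have "vs ! j \<in> (!) vs ` Z \<longleftrightarrow> j \<in> Z"
      using Z j(1) distinct_vs by (auto simp: nth_eq_iff_index_eq image_iff)
    ultimately show ?thesis using side by simp
  qed
  have dist: "distinct es" "inj_on edge_of (set es)"
    using distinct_edges[OF es] by (auto simp: distinct_map)
  have "length (filter ?P es) = card (set (filter ?P es))"
    using dist(1) by (metis distinct_card distinct_filter)
  also have "\<dots> = card (edge_of ` set (filter ?P es))"
    using dist(2) by (intro card_image[symmetric]) (auto intro: inj_on_subset)
  also have "edge_of ` set (filter ?P es) = {e \<in> edge_of ` set es. e \<subseteq> (!) vs ` Z}"
  proof -
    have "?P p \<longleftrightarrow> edge_of p \<subseteq> (!) vs ` Z" if "p \<in> set es" for p
      using edges_in[OF es, of "fst p" "snd p"] that mem by (cases p) (simp add: edge_of_def)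
    then show ?thesis by auto
  qed
  finally show ?thesis .
qed

lemma initial_split_iff_counts:
  assumes A: "represents A k X" "k \<le> n" "X \<subseteq> {..<k}" and es: "(es, l) \<in> set ps"
  shows "initial_split vs (edge_of ` set es) k X \<longleftrightarrow>
    length (filter (\<lambda>(u, v). A 2 u = 2 \<and> A 2 v = 2) es) = card X choose 2 \<and>
    length (filter (\<lambda>(u, v). A 2 u = 1 \<and> A 2 v = 1) es) = 0"
proof -
  have two: "\<forall>e\<in>edge_of ` set es. card e = 2"
    using edges_in[OF es] by (fastforce simp: edge_of_def)
  have "X \<subseteq> {..<n}" using A by auto
  then have "inj_on ((!) vs) X" using distinct_vs by (auto intro!: inj_on_nth)
  then have "card ((!) vs ` X) = card X" by (rule card_image)
  moreover have "finite X" using A(3) finite_subset by blast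
  moreover have "length (filter (\<lambda>(u, v). A 2 u = 2 \<and> A 2 v = 2) es) =
      card {e \<in> edge_of ` set es. e \<subseteq> (!) vs ` X}"
    using A by (intro count_edges_inside[OF es]) (auto simp: represents_def)
  moreover have "length (filter (\<lambda>(u, v). A 2 u = 1 \<and> A 2 v = 1) es) =
      card {e \<in> edge_of ` set es. e \<subseteq> (!) vs ` ({..<k} - X)}"
    using A by (intro count_edges_inside[OF es]) (auto simp: represents_def)
  ultimately show ?thesis
    unfolding initial_split_def
    using clique_iff_card[OF _ two, of "(!) vs ` X"] independent_set_iff_card[OF _ two]
    by simp
qed

lemma wp_sample_prog:
  assumes A: "represents A k X" "k \<le> n" "X \<subseteq> {..<k}" and es: "(es, l) \<in> set ps"
    and words: "drop pos xs = sample_words (es, l) @ ys" "pos \<le> N"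
    and R: "R rPos = pos" "R rK = k" "R rN = n" "R rTri = card X choose 2"
      "R rBad = (if g then 0 else 1)"
  shows "wp w sample_prog (\<lambda>s' \<tau>'. \<exists>R'. s' = (R', A) \<and>
      (\<forall>r. r \<notin> {rL, rM, rX, rY, rE, rPos, rBad} \<longrightarrow> R' r = R r) \<and>
      R' rBad = (if g \<and> sample_ok vs k X (edge_of ` set es, l) then 0 else 1) \<and>
      pos + 2 \<le> R' rPos \<and> R' rPos \<le> N \<and> drop (R' rPos) xs = ys \<and>
      \<tau>' + 60 * pos \<le> \<tau> + 60 * R' rPos) (R, A) \<tau>"
proof -
  have "drop pos xs = of_bool l # length es # concat (map (\<lambda>(u, v). [u, v]) es) @ ys"
    using words by (simp add: sample_words_def)
  note pos = drop_eq_Cons_Cons[OF this]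
  define lv :: nat where "lv = of_bool l"
  have read: "A 0 pos = lv" "A 0 (Suc pos) = length es"
    using A pos(1-3) by (auto simp: represents_def lv_def)
  have fits: "Suc pos < 2 ^ w" "Suc (Suc pos) < 2 ^ w"
    using pos(3) n_less_N by (auto intro!: fits_word_linear)
  have test: "sample_ok vs k X (edge_of ` set es, l) \<longleftrightarrow>
      (if length (filter (\<lambda>(u, v). A 2 u = 2 \<and> A 2 v = 2) es) = card X choose 2 \<and>
          length (filter (\<lambda>(u, v). A 2 u = 1 \<and> A 2 v = 1) es) = 0
       then \<not> (\<not> l \<and> k = n) else \<not> l)"
    unfolding sample_ok_def using initial_split_iff_counts[OF A es] by auto
  show ?thesis
    unfolding sample_prog_def
    apply (simp add: R(1-4) read fits split del: if_split)
    apply (rule wp_mono, rule wp_edges_prog[OF A(1) pos(4,3)])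
         apply simp_all
    apply (elim exE conjE)
    subgoal for s' \<tau>' R'
      using R by (auto simp: test lv_def)
    done
qed

lemma wp_check_prog:
  assumes A: "represents A k X" "k \<le> n" "X \<subseteq> {..<k}"
    and R: "R rN = n" "R rT = length ps" "R rK = k"
  shows "wp w check_prog (\<lambda>s' \<tau>'. \<exists>R'. s' = (R', A) \<and> (\<forall>r<4. R' r = R r) \<and>
      R' rBad = (if ok k X then 0 else 1) \<and> \<tau>' \<le> \<tau> + 150 * N) (R, A) \<tau>"
proof -
  define I where "I i s \<tau>' \<longleftrightarrow> (\<exists>R'. s = (R', A) \<and> (\<forall>r<4. R' r = R r) \<and>
      R' rTri = card X choose 2 \<and> R' rI = i \<and>
      R' rBad = (if \<forall>p\<in>set (take i samples). sample_ok vs k X p then 0 else 1) \<and>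
      R' rPos \<le> N \<and> drop (R' rPos) xs = concat (map sample_words (drop i ps)) \<and>
      \<tau>' \<le> \<tau> + 30 * N + 20 + 80 * R' rPos)" for i s \<tau>'
  have loop: "wp w (While (Less (Reg rI) (Reg rT)) (sample_prog ;; incr rI))
      (\<lambda>s' \<tau>'. \<exists>R'. s' = (R', A) \<and> (\<forall>r<4. R' r = R r) \<and>
        R' rBad = (if ok k X then 0 else 1) \<and> \<tau>' \<le> \<tau> + 150 * N) s \<tau>'"
    if "I 0 s \<tau>'" for s \<tau>'
    using that
  proof (rule wp_for[where m = "length ps"], goal_cases)
    case (1 i s \<tau>)
    then show ?case using R by (auto simp: I_def)
  next
    case (2 i s \<tau>')
    then obtain R' where s: "s = (R', A)" and frame: "\<forall>r<4. R' r = R r"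
      and R': "R' rTri = card X choose 2" "R' rI = i"
        "R' rBad = (if \<forall>p\<in>set (take i samples). sample_ok vs k X p then 0 else 1)"
      and pos: "R' rPos \<le> N" "drop (R' rPos) xs = concat (map sample_words (drop i ps))"
      and time: "\<tau>' \<le> \<tau> + 30 * N + 20 + 80 * R' rPos"
      unfolding I_def by blast
    obtain es l where es: "ps ! i = (es, l)" by fastforce
    then have mem: "(es, l) \<in> set ps" using 2 by (metis nth_mem)
    have "drop i ps = (es, l) # drop (Suc i) ps" using 2 es by (metis Cons_nth_drop_Suc)
    with pos have words: "drop (R' rPos) xs =
        sample_words (es, l) @ concat (map sample_words (drop (Suc i) ps))"
      by simp
    have step: "set (take (Suc i) samples) =
        insert (edge_of ` set es, l) (set (take i samples))"
      using 2 es by (simp add: samples_def take_Suc_conv_app_nth)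
    have fits: "Suc i < 2 ^ w"
      using 2 length_ps_less_N by (intro fits_word_linear) simp
    show ?case
      unfolding s
      apply simp
      apply (rule wp_mono)
       apply (rule wp_sample_prog[OF A mem words pos(1) refl _ _ R'(1) R'(3)])
      using frame R apply simp
      using frame R apply simp
      apply (elim exE conjE)
      subgoal for s'' \<tau>'' R''
        using time frame R'(1,2) fits step by (auto simp: I_def)
      done
  next
    case (3 s \<tau>')
    moreover have "take (length ps) samples = samples" by (simp add: samples_def)
    ultimately show ?case using n_less_N by (auto simp: I_def)
  qed
  have fits: "Suc (Suc n) < 2 ^ w" using n_less_N by (intro fits_word_linear) simp
  have drop: "drop (Suc (Suc n)) xs = concat (map sample_words ps)"
    by (simp add: instance_words_def)
  show ?thesis
    unfolding check_prog_def wp_Seq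
    apply (rule wp_mono, rule wp_count_prog[where R = R, OF A R(3)])
    apply (elim exE conjE)
    subgoal for s' \<tau>' R'
      unfolding wp_Assign
      apply (rule loop)
      using R fits drop n_less_N by (auto simp: I_def)
    done
qed

lemma represents_update:
  assumes "represents A k X" "g < n"
    and "\<And>j. j < n \<Longrightarrow> j \<noteq> g \<Longrightarrow> (j < k' \<longleftrightarrow> j < k) \<and> (j \<in> X' \<longleftrightarrow> j \<in> X)"
    and "c = (if g < k' then if g \<in> X' then 2 else 1 else 0)"
  shows "represents (A(2 := (A 2)(vs ! g := c))) k' X'"
proof -
  have "((A 2)(vs ! g := c)) (vs ! j) = (if j < k' then if j \<in> X' then 2 else 1 else 0)"
    if "j < n" for j
  proof (cases "j = g")
    case True
    then show ?thesis using assms(4) by simp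
  next
    case False
    then have "vs ! j \<noteq> vs ! g" using that assms(2) distinct_vs by (simp add: nth_eq_iff_index_eq)
    then show ?thesis using assms(1) assms(3)[OF that False] that by (simp add: represents_def)
  qed
  with assms(1) show ?thesis by (simp add: represents_def)
qed

lemma wp_backtrack_prog:
  assumes A: "represents A k X" and inv: "backtrack_inv n ok D k X"
    and R: "R rK = k" "R rRun = 1"
  shows "wp w backtrack_prog (\<lambda>s' \<tau>'. \<exists>R' A' k' X'. s' = (R', A') \<and>
      (\<forall>r. r \<notin> {rK, rRun} \<longrightarrow> R' r = R r) \<and> R' rK = k' \<and> represents A' k' X' \<and>
      (R' rRun = 0 \<and> (\<forall>Z\<subseteq>{..<n}. \<not> ok n Z) \<or>
       R' rRun = 1 \<and> search_inv n ok D k' X' \<and> k + card X' = Suc (k' + card X)) \<and>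
      \<tau>' \<le> \<tau> + 30 * N) (R, A) \<tau>"
proof -
  have k: "k \<le> n" using inv by (simp add: backtrack_inv_def)
  define I where "I f s \<tau>' \<longleftrightarrow> (\<exists>R' A' X'. s = (R', A') \<and>
      (\<forall>r. r \<noteq> rK \<longrightarrow> R' r = R r) \<and> R' rK = f \<and> represents A' f X' \<and>
      backtrack_inv n ok D f X' \<and> k + card X' = f + card X \<and>
      \<tau>' + 30 * f \<le> \<tau> + 30 * k)" for f s \<tau>'
  show ?thesis
    unfolding backtrack_prog_def
  proof (simp, rule wp_While[where I = I and f = k], goal_cases)
    case 1
    then show ?case using A inv R by (auto simp: I_def)
  next
    case (2 f s \<tau>')
    then obtain R' A' X' where s: "s = (R', A')" and R': "\<forall>r. r \<noteq> rK \<longrightarrow> R' r = R r" "R' rK = f"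
      and A': "represents A' f X'" and inv': "backtrack_inv n ok D f X'"
      and cards: "k + card X' = f + card X" and time: "\<tau>' + 30 * f \<le> \<tau> + 30 * k"
      unfolding I_def by blast
    from 2(2) obtain g where g: "f = Suc g" using R' by (cases f) (auto simp: s)
    have X': "X' \<subseteq> {..<f}" and gn: "g < n" using inv' g by (auto simp: backtrack_inv_def)
    have read: "A' 0 f = vs ! g" using read_vertex[OF A' gn] g by simp
    then have mem: "g \<in> X'"
      using 2(2) A' gn R' g by (auto simp: s represents_def split: if_splits)
    have "finite X'" using X' finite_subset by blast
    then have "Suc (card (X' - {g})) = card X'" using mem by (rule card_Suc_Diff1)
    moreover have "represents (A'(2 := (A' 2)(vs ! g := 0))) g (X' - {g})"
      by (rule represents_update[OF A' gn]) (auto simp: g)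
    moreover have "backtrack_inv n ok D g (X' - {g})"
      using backtrack_inv_pop inv' mem g by blast
    ultimately have "I g (R'(rK := g), A'(2 := (A' 2)(vs ! g := 0))) t" if "t \<le> \<tau>' + 30" for t
      unfolding I_def using R' cards time g that
      by (intro exI[of _ "R'(rK := g)"] exI[of _ "A'(2 := (A' 2)(vs ! g := 0))"] exI[of _ "X' - {g}"])
        auto
    then show ?case using g read R' unfolding s by (auto intro!: exI[of _ g])
  next
    case (3 f s \<tau>')
    then obtain R' A' X' where s: "s = (R', A')" and R': "\<forall>r. r \<noteq> rK \<longrightarrow> R' r = R r" "R' rK = f"
      and A': "represents A' f X'" and inv': "backtrack_inv n ok D f X'"
      and cards: "k + card X' = f + card X" and time: "\<tau>' + 30 * f \<le> \<tau> + 30 * k"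
      unfolding I_def by blast
    have time': "\<tau>' + 30 \<le> \<tau> + 30 * N" using time k n_less_N by linarith
    show ?case
    proof (cases f)
      case 0
      then have "\<forall>Z\<subseteq>{..<n}. \<not> ok n Z" using backtrack_inv_exhausted inv' by blast
      with 0 show ?thesis using R' A' time' by (auto simp: s)
    next
      case (Suc g)
      have X': "X' \<subseteq> {..<f}" and gn: "g < n" using inv' Suc by (auto simp: backtrack_inv_def)
      have read: "A' 0 f = vs ! g" using read_vertex[OF A' gn] Suc by simp
      then have mem: "g \<notin> X'"
        using 3(2) A' gn R' Suc by (auto simp: s represents_def split: if_splits)
      have "finite X'" using X' finite_subset by blast
      then have "card (insert g X') = Suc (card X')" using mem by simp
      moreover have "represents (A'(2 := (A' 2)(vs ! g := 2))) f (insert g X')"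
        by (rule represents_update[OF A' gn]) (auto simp: Suc)
      moreover have "search_inv n ok D f (insert g X')"
        using backtrack_inv_flip inv' mem Suc by blast
      ultimately show ?thesis
        using R' R cards time' read Suc by (auto simp: s intro!: exI[of _ "insert g X'"])
    qed
  qed
qed

lemma ok_restrict: "ok n Z \<Longrightarrow> Z \<subseteq> {..<n} \<Longrightarrow> k \<le> n \<Longrightarrow> ok k (Z \<inter> {..<k})"
  using sample_ok_restrict by blast

lemma wp_search_prog:
  assumes A: "represents A 0 {}" and R: "R rN = n" "R rT = length ps" "R rK = 0" "R rRun = 1"
  shows "wp w search_prog (\<lambda>s' \<tau>'. \<exists>R' A' X. s' = (R', A') \<and> R' rN = n \<and>
      (R' rRun = 0 \<and> A' 1 = (\<lambda>_. 0) \<and> (\<forall>Z\<subseteq>{..<n}. \<not> ok n Z) \<or>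
       R' rRun = 2 \<and> represents A' n X \<and> X \<subseteq> {..<n} \<and> ok n X) \<and>
      \<tau>' \<le> \<tau> + (2 * card (dead_ends n ok) + n + 2) * (200 * N)) (R, A) \<tau>"
proof -
  define M where "M = 2 * card (dead_ends n ok) + n + 1"
  define I where "I f s \<tau>' \<longleftrightarrow> (\<exists>R A k X D. s = (R, A) \<and> R rN = n \<and> R rT = length ps \<and>
      R rK = k \<and> represents A k X \<and>
      (R rRun = 1 \<and> search_inv n ok D k X \<and> f + 2 * card D + k = M + card X \<or>
       R rRun = 2 \<and> k = n \<and> X \<subseteq> {..<n} \<and> ok n X \<or>
       R rRun = 0 \<and> (\<forall>Z\<subseteq>{..<n}. \<not> ok n Z)) \<and>
      \<tau>' + f * (200 * N) \<le> \<tau> + M * (200 * N))" for f s \<tau>'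
  have I_intro: "I f (R, A) \<tau>'"
    if "R rN = n" "R rT = length ps" "R rK = k" "represents A k X"
      "R rRun = 1 \<and> search_inv n ok D k X \<and> f + 2 * card D + k = M + card X \<or>
       R rRun = 2 \<and> k = n \<and> X \<subseteq> {..<n} \<and> ok n X \<or>
       R rRun = 0 \<and> (\<forall>Z\<subseteq>{..<n}. \<not> ok n Z)"
      "\<tau>' + f * (200 * N) \<le> \<tau> + M * (200 * N)" for f R A \<tau>' k X D
    unfolding I_def using that by (intro exI conjI) auto
  show ?thesis
    unfolding search_prog_def
  proof (rule wp_While[where I = I and f = M], goal_cases)
    case 1
    show ?case
      by (rule I_intro[where k = 0 and X = "{}" and D = "{}"])
        (use A R search_inv_start in auto)
  next
    case (2 f s \<tau>')
    then obtain R A k X D where s: "s = (R, A)"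
      and R: "R rN = n" "R rT = length ps" "R rK = k" "R rRun = 1"
      and A: "represents A k X" and inv: "search_inv n ok D k X"
      and fuel: "f + 2 * card D + k = M + card X"
      and time: "\<tau>' + f * (200 * N) \<le> \<tau> + M * (200 * N)"
      unfolding I_def by fastforce
    have k: "k \<le> n" and X: "X \<subseteq> {..<k}" and D: "D \<subseteq> dead_ends n ok"
      using inv by (auto simp: search_inv_def)
    have finite: "finite D" using D finite_dead_ends finite_subset by blast
    have "card D \<le> card (dead_ends n ok)" using D finite_dead_ends card_mono by blast
    then obtain f' where f': "f = Suc f'" using fuel k by (cases f) (auto simp: M_def)
    have time': "\<tau>'' + f' * (200 * N) \<le> \<tau> + M * (200 * N)" if "\<tau>'' \<le> \<tau>' + 200 * N" for \<tau>''
      using time that by (simp add: f')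
    have body: "wp w
        (Ite (Equal (Reg rBad) (Const 0))
          (Ite (Less (Reg rK) (Reg rN))
             (incr rK ;; Write 2 (Read 0 (Reg rK)) (Const 1))
             (Assign rRun (Const 2)))
          backtrack_prog)
        (\<lambda>s' \<tau>'. \<exists>f'<f. I f' s' \<tau>') (R', A) \<tau>''"
      if R': "\<forall>r<4. R' r = R r" and bad: "R' rBad = (if ok k X then 0 else 1)"
        and \<tau>'': "\<tau>'' \<le> \<tau>' + 5 + 150 * N" for R' \<tau>''
    proof -
      have regs: "R' rN = n" "R' rT = length ps" "R' rK = k" "R' rRun = 1"
        using R R' by auto
      consider (descend) "ok k X" "k < n" | (found) "ok k X" "k = n" | (dead) "\<not> ok k X"
        using k by linarith
      then show ?thesis
      proof cases
        case descend
        have read: "A 0 (Suc k) = vs ! k" using read_vertex[OF A] descend by blast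
        have fits: "Suc k < 2 ^ w"
          using descend n_less_N by (intro fits_word_linear) simp
        have rep: "represents (A(2 := (A 2)(vs ! k := Suc 0))) (Suc k) X"
          using X descend by (intro represents_update[OF A]) auto
        have "I f' (R'(rK := Suc k), A(2 := (A 2)(vs ! k := Suc 0))) t" if "t \<le> \<tau>'' + 40" for t
          by (rule I_intro[OF _ _ _ rep, where D = D])
            (use regs search_inv_descend[OF inv descend] fuel f' time' \<tau>'' n_less_N that in auto)
        then show ?thesis
          using descend bad regs read fits f' by (auto intro!: exI[of _ f'])
      next
        case found
        have "I f' (R'(rRun := 2), A) t" if "t \<le> \<tau>'' + 40" for t
          by (rule I_intro[OF _ _ _ A, where D = D])
            (use regs found X time' \<tau>'' n_less_N that in auto)
        then show ?thesis
          using found bad regs f' by (auto intro!: exI[of _ f'])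
      next
        case dead
        have bt: "backtrack_inv n ok (insert (k, X) D) k X" "(k, X) \<notin> D"
          using backtrack_inv_start[of n ok D k X, OF inv dead ok_restrict] by simp_all
        have card: "card (insert (k, X) D) = Suc (card D)" using bt(2) finite by simp
        have "R' rBad = 1" using dead bad by auto
        then show ?thesis
          apply simp
          apply (rule wp_mono, rule wp_backtrack_prog[where R = R', OF A bt(1) regs(3,4)])
          apply (elim exE conjE)
          subgoal for s' \<sigma> R'' A' k' X'
            apply (intro exI[of _ f'])
            apply (simp add: f' del: insert_iff)
            apply (rule I_intro[where k = k' and X = X' and D = "insert (k, X) D"])
            using regs fuel f' card time' \<tau>'' n_less_N by auto
          done
      qed
    qed
    show ?case
      unfolding s
      apply simp
      apply (rule wp_mono, rule wp_check_prog[where R = R, OF A k X R(1-3)])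
      apply (elim exE conjE)
      subgoal for s' \<tau>'' R'
        using body[of R' \<tau>''] by (simp add: add.commute)
      done
  next
    case (3 f s \<tau>')
    then obtain R A k X where s: "s = (R, A)" and R: "R rN = n" and A: "represents A k X"
      and res: "R rRun = 2 \<and> k = n \<and> X \<subseteq> {..<n} \<and> ok n X \<or>
        R rRun = 0 \<and> (\<forall>Z\<subseteq>{..<n}. \<not> ok n Z)"
      and time: "\<tau>' + f * (200 * N) \<le> \<tau> + M * (200 * N)"
      unfolding I_def by fastforce
    have "\<tau>' + 4 \<le> \<tau> + (M + 1) * (200 * N)"
      using time n_less_N unfolding add_mult_distrib by linarith
    moreover have "A 1 = (\<lambda>_. 0)" using A by (simp add: represents_def)
    ultimately show ?case
      using A R res unfolding s M_def by (intro exI[of _ R] exI[of _ A] exI[of _ X]) auto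
  qed
qed

definition listing :: "nat set \<Rightarrow> nat \<Rightarrow> nat list" where
  "listing X j = map ((!) vs) (filter (\<lambda>i. i \<in> X) [0..<j])"

lemma wp_output_prog:
  assumes A: "represents A n X" and R: "R rN = n"
  shows "wp w output_prog (\<lambda>s' \<tau>'.
      has_output s' (1 # length (listing X n) # listing X n) \<and> \<tau>' \<le> \<tau> + 60 * N) (R, A) \<tau>"
proof -
  define I where "I j s \<tau>' \<longleftrightarrow> (\<exists>R' B. s = (R', A(1 := B)) \<and> R' rN = n \<and> R' rJ = j \<and>
      R' rP = length (listing X j) \<and> B 0 = 1 \<and>
      (\<forall>i<length (listing X j). B (i + 2) = listing X j ! i) \<and>
      \<tau>' \<le> \<tau> + 10 + 50 * j)" for j s \<tau>'
  show ?thesis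
    unfolding output_prog_def
  proof (simp, rule wp_for[where I = I and m = n], goal_cases)
    case 1
    then show ?case using R by (auto simp: I_def listing_def intro!: exI[of _ "(A 1)(0 := 1)"])
  next
    case (2 j s \<tau>)
    then show ?case by (auto simp: I_def)
  next
    case (3 j s \<tau>')
    then obtain R' B where s: "s = (R', A(1 := B))" and R': "R' rN = n" "R' rJ = j"
        "R' rP = length (listing X j)"
      and B: "B 0 = 1" "\<And>i. i < length (listing X j) \<Longrightarrow> B (i + 2) = listing X j ! i"
      and time: "\<tau>' \<le> \<tau> + 10 + 50 * j"
      unfolding I_def by blast
    define p where "p = length (listing X j)"
    have p: "p \<le> j"
      unfolding p_def listing_def using length_filter_le[of "\<lambda>i. i \<in> X" "[0..<j]"] by simp
    have fits: "Suc p < 2 ^ w" "Suc (Suc p) < 2 ^ w" "Suc j < 2 ^ w"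
      using p 3 n_less_N by (auto intro!: fits_word_linear)
    have read: "A 0 (Suc j) = vs ! j" using read_vertex[OF A 3(1)] .
    have side: "A 2 (vs ! j) = (if j \<in> X then 2 else 1)"
      using A 3(1) by (simp add: represents_def)
    have step: "listing X (Suc j) = (if j \<in> X then listing X j @ [vs ! j] else listing X j)"
      by (simp add: listing_def)
    show ?case
    proof (cases "j \<in> X")
      case True
      define B' where "B' = B(Suc (Suc p) := vs ! j)"
      have "\<forall>i<length (listing X (Suc j)). B' (i + 2) = listing X (Suc j) ! i"
        using B(2) True by (auto simp: B'_def step p_def nth_append less_Suc_eq)
      moreover have "B' 0 = 1" using B by (simp add: B'_def)
      ultimately have "I (Suc j) (R'(rP := Suc p, rJ := Suc j), A(1 := B')) (\<tau>' + 35)"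
        unfolding I_def using R' time True
        by (intro exI[of _ "R'(rP := Suc p, rJ := Suc j)"] exI[of _ B']) (simp add: step p_def)
      then show ?thesis
        unfolding I_def s using True R' read side fits
        by (auto simp: p_def[symmetric] B'_def[symmetric])
    next
      case False
      then show ?thesis
        unfolding I_def s using R' read side fits step time B by auto
    qed
  next
    case (4 s \<tau>')
    then obtain R' B where s: "s = (R', A(1 := B))" and R': "R' rP = length (listing X n)"
      and B: "B 0 = 1" "\<And>i. i < length (listing X n) \<Longrightarrow> B (i + 2) = listing X n ! i"
      and time: "\<tau>' \<le> \<tau> + 10 + 50 * n"
      unfolding I_def by blast
    have "has_output (R', A(1 := B(Suc 0 := length (listing X n))))
        (1 # length (listing X n) # listing X n)"
      using B by (auto simp: has_output_def nth_Cons split: nat.splits)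
    then show ?case using R' time n_less_N by (simp add: s)
  qed
qed

lemma is_split_iff_initial_split:
  assumes "X \<subseteq> {..<n}"
  shows "is_split (set vs) E ((!) vs ` X) (set vs - (!) vs ` X) \<longleftrightarrow> initial_split vs E n X"
proof -
  have V: "set vs = (!) vs ` {..<n}" by (auto simp: in_set_conv_nth image_iff)
  have "inj_on ((!) vs) {..<n}" using distinct_vs by (auto intro!: inj_on_nth)
  then have "set vs - (!) vs ` X = (!) vs ` ({..<n} - X)"
    unfolding V using assms by (simp add: inj_on_image_set_diff[of _ "{..<n}"])
  moreover have "(!) vs ` X \<subseteq> set vs" unfolding V using assms by blast
  ultimately show ?thesis by (auto simp: is_split_def initial_split_def)
qed

lemma split_consistent_iff_ok:
  assumes "X \<subseteq> {..<n}"
  shows "split_consistent (set vs) samples ((!) vs ` X) \<longleftrightarrow> ok n X"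
proof -
  have "(!) vs ` X \<subseteq> set vs" using assms by auto
  then show ?thesis
    unfolding split_consistent_def sample_ok_def all_set_conv_all_nth
    by (auto simp: is_split_iff_initial_split[OF assms])
qed

lemma split_consistent_imp_ok:
  assumes "split_consistent (set vs) samples Y"
  obtains X where "X \<subseteq> {..<n}" "ok n X"
proof -
  define X where "X = {j. j < n \<and> vs ! j \<in> Y}"
  have "Y \<subseteq> set vs" using assms by (simp add: split_consistent_def)
  then have "(!) vs ` X = Y" by (auto simp: X_def in_set_conv_nth image_iff) (metis in_set_conv_nth subsetD)
  then show thesis
    using that[of X] assms split_consistent_iff_ok[of X] by (auto simp: X_def)
qed

lemma wp_split_prog:
  "wp w split_prog (\<lambda>s' \<tau>'.
     (\<exists>ys. has_output s' ys \<and> conscheck_split_answer (set vs, samples) ys) \<and>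
     \<tau>' \<le> 2000 * N ^ 3) (init_state xs) 0"
proof -
  let ?d = "card (dead_ends n ok)"
  have fits: "Suc n < 2 ^ w" using n_less_N by (intro fits_word_linear) simp
  have xs: "xs ! 0 = n" "xs ! Suc n = length ps" "xs \<noteq> []" "Suc n < N"
    using n_less_N by (simp_all add: instance_words_def nth_append)
  have rep: "represents (snd (init_state xs)) 0 {}"
    by (auto simp: represents_def init_state_def)
  have "?d \<le> 2 * (Suc n) ^ 2 + length samples * Suc n"
    by (rule card_dead_ends[OF distinct_vs])
  also have "\<dots> \<le> 2 * N ^ 2 + N * N"
    using n_less_N length_ps_less_N
    by (intro add_mono mult_le_mono power_mono) (auto simp: samples_def)
  finally have "2 * ?d + n + 2 \<le> 6 * N ^ 2 + N"
    using n_less_N by (simp add: power2_eq_square)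
  also have "\<dots> \<le> 7 * N ^ 2" using le_square[of N] by (simp add: power2_eq_square)
  finally have "(2 * ?d + n + 2) * (200 * N) \<le> 7 * N ^ 2 * (200 * N)"
    by (rule mult_right_mono) simp
  also have "\<dots> = 1400 * N ^ 3" by (simp add: power2_eq_square power3_eq_cube)
  finally have time: "(2 * ?d + n + 2) * (200 * N) \<le> 1400 * N ^ 3" .
  have "1 \<le> N ^ 2" using xs by (simp add: Suc_le_eq)
  then have N3: "N \<le> N ^ 3" using mult_le_mono2[of 1 "N ^ 2" N] by (simp add: power2_eq_square power3_eq_cube)
  have final: "(\<exists>ys. has_output s' ys \<and> conscheck_split_answer (set vs, samples) ys)"
    if "X \<subseteq> {..<n}" "ok n X" "has_output s' (1 # length (listing X n) # listing X n)" for s' X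
  proof -
    have "set (listing X n) = (!) vs ` X" using that(1) by (auto simp: listing_def)
    moreover have "distinct (listing X n)"
      using distinct_vs by (auto simp: listing_def distinct_map intro!: inj_on_nth)
    ultimately have "conscheck_split_answer (set vs, samples) (1 # length (listing X n) # listing X n)"
      using that split_consistent_iff_ok[OF that(1)] by (auto simp: conscheck_split_answer_def)
    with that(3) show ?thesis by blast
  qed
  show ?thesis
    unfolding split_prog_def
  proof (simp add: init_state_def xs fits, rule wp_mono[OF wp_search_prog], goal_cases)
    case 1
    then show ?case using rep by (simp add: init_state_def)
  next
    case (6 s' \<tau>')
    then obtain R A X where s': "s' = (R, A)" and R: "R rN = n" and
      res: "R rRun = 0 \<and> A 1 = (\<lambda>_. 0) \<and> (\<forall>Z\<subseteq>{..<n}. \<not> ok n Z) \<or>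
        R rRun = 2 \<and> represents A n X \<and> X \<subseteq> {..<n} \<and> ok n X"
      and \<tau>': "\<tau>' \<le> 10 + (2 * ?d + n + 2) * (200 * N)"
      by auto
    have \<tau>'': "\<tau>' \<le> 1410 * N ^ 3" using \<tau>' time N3 n_less_N by linarith
    from res show ?case
    proof (elim disjE conjE)
      assume none: "R rRun = 0" "A 1 = (\<lambda>_. 0)" "\<forall>Z\<subseteq>{..<n}. \<not> ok n Z"
      then have "conscheck_split_answer (set vs, samples) [0]"
        unfolding conscheck_split_answer_def by (auto elim!: split_consistent_imp_ok)
      moreover have "has_output (R, A) [0]" using none by (simp add: has_output_def)
      ultimately show ?thesis using none \<tau>'' N3 n_less_N by (auto simp: s')
    next
      assume found: "R rRun = 2" "represents A n X" "X \<subseteq> {..<n}" "ok n X"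
      then show ?thesis
        unfolding s'
      proof (simp, intro wp_mono[OF wp_output_prog[where R = R, OF found(2) R]], goal_cases)
        case (1 s'' \<sigma>)
        then show ?case using final[OF found(3,4)] \<tau>'' N3 n_less_N by auto
      qed
    qed
  qed simp_all
qed

end

theorem theorem4:
  "solvable_in_time conscheck_split_input conscheck_split_answer (\<lambda>N. real N ^ 3)"
  unfolding solvable_in_time_def
proof (rule exI[of _ split_prog], rule exI[of _ 3], rule exI[of _ "\<lambda>N. 2000 * real N ^ 3"],
    intro conjI allI impI)
  show "(\<lambda>N. 2000 * real N ^ 3) \<in> O(\<lambda>N. real N ^ 3)" by simp
next
  fix I :: "nat set \<times> (nat set set \<times> bool) list" and xs w
  assume enc: "conscheck_split_input xs I" and word: "word_size_ok 3 w xs"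
  obtain V S where I: "I = (V, S)" by fastforce
  from enc obtain vs ps where inst: "split_instance V S" and vs: "distinct vs" "set vs = V"
    and ps: "\<forall>(es, l)\<in>set ps. distinct (map edge_of es)"
    and S: "S = map (\<lambda>(es, l). (edge_of ` set es, l)) ps" and xs: "xs = instance_words vs ps"
    unfolding conscheck_split_input_def I by blast
  interpret split_input w vs ps
  proof
    fix es l u v assume es: "(es, l) \<in> set ps" and uv: "(u, v) \<in> set es"
    then have "graph_on V (edge_of ` set es)"
      using inst S by (force simp: split_instance_def)
    then have "{u, v} \<in> {{a, b} |a b. a \<in> V \<and> b \<in> V \<and> a \<noteq> b}"
      using imageI[OF uv, of edge_of] unfolding graph_on_def edge_of_def by auto
    then show "u \<in> set vs \<and> v \<in> set vs \<and> u \<noteq> v"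
      using vs by (auto simp: doubleton_eq_iff)
  qed (use vs ps word xs in \<open>auto simp: word_size_ok_def\<close>)
  from wp_split_prog obtain \<tau> s ys where
    "exec w split_prog (init_state xs) \<tau> s" "\<tau> \<le> 2000 * length xs ^ 3"
    "has_output s ys" "conscheck_split_answer I ys"
    unfolding wp_def I S xs samples_def vs(2) by auto
  moreover from this(2) have "real \<tau> \<le> 2000 * real (length xs) ^ 3"
    using of_nat_mono[of \<tau> "2000 * length xs ^ 3", where 'a = real] by simp
  ultimately show "\<exists>\<tau> s ys. exec w split_prog (init_state xs) \<tau> s \<and>
      real \<tau> \<le> 2000 * real (length xs) ^ 3 \<and> has_output s ys \<and> conscheck_split_answer I ys"
    by blast
qed

end
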